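(* Assume that $\{d_k\}$ is dense in the unit sphere $S(0,1)$. Then the sequence $\{x_k\}$ generated by Algorithm DFN-LLA (applied to the perturbed objective $P$) when $\bar\zeta>0$ is eventually constant, with the unique limit point being $(\delta,\epsilon)$-Goldstein stationary for the problem $\min_{x\in X}\bar F(x)$, with $$\epsilon=4\gamma\alpha_{\min}+\frac{8L_F\bar\zeta}{\alpha_{\min}}\qquad\text{and}\qquad\delta=\alpha_{\min}.$$
   Context: **Problem and standing assumptions.** Let $l,u\in\mathbb{R}^{n_x}$ and $X=\{x\in\mathbb{R}^{n_x}: l_i\le x_i\le u_i,\ i=1,\dots,n_x\}$. Let $F:\mathbb{R}^{n_x+n_y}\to\mathbb{R}$ (upper-level objective), $f:\mathbb{R}^{n_x+n_y}\to\mathbb{R}$ (lower-level objective), $\mathcal{Z}\subseteq\mathbb{R}^{n_y}$, and $\mathcal{R}(x)=\arg\min_{z\in\mathcal{Z}}f(x,z)$. Throughout, assume: there are mappings $y:\mathbb{R}^{n_x}\to\mathbb{R}^{n_y}$ and $\tilde y:\mathbb{R}^{n_x}\times\mathbb{R}\to\mathbb{R}^{n_y}$ such that for all $x\in X$, $\zeta>0$: (a) $y(x)\in\mathcal{R}(x)$; (b) $\|\tilde y(x,\zeta)-y(x)\|\le\zeta$. Put $\bar F(x)=F(x,y(x))$ and $P(x,\zeta)=F(x,\tilde y(x,\zeta))$. Assume also: (i) $F(x,y)$ is Lipschitz continuous with respect to $y$ with constant $L_F$; (ii) $\bar F$ is Lipschitz continuous with constant $L_{\bar F}$; (iii) there is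 $F_{low}>-\infty$ with $\bar F(x)\ge F_{low}$ for all $x\in X$. **Notation.** $\|\cdot\|$ is the Euclidean norm; $[x]_{[l,u]}=\max\{l,\min\{u,x\}\}$ (componentwise) is the projection onto $X$; $S(0,1)=\{x\in\mathbb{R}^{n_x}:\|x\|=1\}$; $B_\delta(\bar x)=\{x\in\mathbb{R}^{n_x}:\|\bar x-x\|\le\delta\}$. **Procedure ProjectedExtrapolation$(\tilde\alpha,x,d,\zeta)$**, with constants $\gamma>0$, $\hat\delta\in(0,1)$ ($\hat\delta$ is unrelated to the Goldstein parameter $\delta$). Set $\alpha=\tilde\alpha$. If $P([x+\alpha d]_{[l,u]},\zeta)\le P(x,\zeta)-\gamma\alpha^2$, set $p^+=d$; else if $P([x-\alpha d]_{[l,u]},\zeta)\le P(x,\zeta)-\gamma\alpha^2$, set $p^+=-d$; else return $(0,d)$. Then loop: set $\beta=\alpha/\hat\delta$; if $P([x+\beta p^+]_{[l,u]},\zeta)>P(x,\zeta)-\gamma\beta^2$, return $(\alpha,p^+)$; otherwise set $\alpha=\beta$ and repeat the loop. **Algorithm DFN-LLA.** Input: $\theta\in(0,1)$, $\sigma\in(0,1)$, $\bar\zeta\ge0$, $x_0\in X$, directions $\{d_k\}\subset\mathbb{R}^{n_x}$ with $\|d_k\|=1$ for all $k$. Set $\alpha_{\min}=(\sigma\bar\zeta)^{1/3}$, choose $\zeta_0\ge\bar\zeta$ and $\tilde\alpha_0\ge\zeta_0^{1/3}$. For $k=0,1,2,\dots$: let $(\alpha_k,\tilde d_k)=$ ProjectedExtrapolation$(\tilde\alpha_k,x_k,d_k,\zeta_k)$.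 - If $\alpha_k=0$ (unsuccessful iteration): $\tilde\alpha_{k+1}=\max\{\alpha_{\min},\theta\tilde\alpha_k\}$, $x_{k+1}=x_k$; and $\zeta_{k+1}=\max\{\bar\zeta,\min\{\theta\zeta_k,\tilde\alpha_{k+1}^3\}\}$ if $\tilde\alpha_{k+1}^3<\zeta_k$, while $\zeta_{k+1}=\zeta_k$ otherwise. - If $\alpha_k>0$ (successful iteration): $\tilde\alpha_{k+1}=\alpha_k$, $\tilde x_k=[x_k+\alpha_k\tilde d_k]_{[l,u]}$, $\zeta_{k+1}=\zeta_k$, and $x_{k+1}$ is any point of $X$ with $P(x_{k+1},\zeta_k)\le P(\tilde x_k,\zeta_k)$. There is no stopping condition. **Density.** $\{d_k\}$ is dense in $S(0,1)$ if for any $\bar d\in S(0,1)$ and any $\varepsilon>0$ there is an index $k$ with $\|d_k-\bar d\|\le\varepsilon$. **Stationarity.** The cone of feasible directions at $x\in X$ is $D(x)=\{d\in\mathbb{R}^{n_x}: d_i\ge0\text{ if }x_i=l_i,\ d_i\le0\text{ if }x_i=u_i,\ d_i\in\mathbb{R}\text{ otherwise}\}$. The Clarke directional derivative is $\bar F^{Cl}(\bar x,d)=\limsup_{x\to\bar x,\,t\downarrow0}\frac{\bar F(x+td)-\bar F(x)}{t}$ and the Clarke subdifferential is $\partial\bar F(\bar x)=\{\xi\in\mathbb{R}^{n_x}:\bar F^{Cl}(\bar x,d)\ge\xi^\top d\ \ \forall d\in\mathbb{R}^{n_x}\}$. Given $\delta,\epsilon>0$, a point $\bar x\in X$ is $(\delta,\epsilon)$-Goldstein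 stationary for $\min_{x\in X}\bar F(x)$ if there exist $\tilde x\in B_\delta(\bar x)\cap X$ and $\xi\in\partial\bar F(\tilde x)$ such that $\xi^\top d\ge-\epsilon$ for all $d\in D(\tilde x)\cap S(0,1)$. *)

theory Defs
  imports "HOL-Analysis.Analysis"
begin

definition reaction_set ::
    "(real^'n \<Rightarrow> real^'m \<Rightarrow> real) \<Rightarrow> (real^'m) set \<Rightarrow> real^'n \<Rightarrow> (real^'m) set" where
  "reaction_set f Z x = {z. is_arg_min (f x) (\<lambda>z. z \<in> Z) z}"

definition true_objective ::
    "(real^'n \<Rightarrow> real^'m \<Rightarrow> real) \<Rightarrow> (real^'n \<Rightarrow> real^'m) \<Rightarrow> real^'n \<Rightarrow> real" where
  "true_objective F y x = F x (y x)"

definition perturbed_objective ::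
    "(real^'n \<Rightarrow> real^'m \<Rightarrow> real) \<Rightarrow> (real^'n \<Rightarrow> real \<Rightarrow> real^'m) \<Rightarrow> real^'n \<Rightarrow> real \<Rightarrow> real" where
  "perturbed_objective F yt x \<zeta> = F x (yt x \<zeta>)"

definition box_proj :: "real^'n \<Rightarrow> real^'n \<Rightarrow> real^'n \<Rightarrow> real^'n" where
  "box_proj l u x = (\<chi> i. max (l $ i) (min (u $ i) (x $ i)))"

definition sufficient_decrease ::
    "(real^'n \<Rightarrow> real \<Rightarrow> real) \<Rightarrow> real^'n \<Rightarrow> real^'n \<Rightarrow> real
      \<Rightarrow> real^'n \<Rightarrow> real \<Rightarrow> real^'n \<Rightarrow> real \<Rightarrow> bool" where
  "sufficient_decrease P l u \<gamma> x \<zeta> p \<alpha> \<longleftrightarrow>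
     P (box_proj l u (x + \<alpha> *\<^sub>R p)) \<zeta> \<le> P x \<zeta> - \<gamma> * \<alpha>\<^sup>2"

text \<open>The loop entered with step \<open>\<alpha>\<close> terminates and returns the step in the last argument.
  Being an inductive (least) relation, it relates \<open>\<alpha>\<close> to nothing if the loop does not terminate.\<close>

inductive expansion_loop ::
    "(real^'n \<Rightarrow> real \<Rightarrow> real) \<Rightarrow> real^'n \<Rightarrow> real^'n \<Rightarrow> real \<Rightarrow> real
      \<Rightarrow> real^'n \<Rightarrow> real \<Rightarrow> real^'n \<Rightarrow> real \<Rightarrow> real \<Rightarrow> bool"
  for P l u \<gamma> \<delta>h x \<zeta> p where
  stop: "\<not> sufficient_decrease P l u \<gamma> x \<zeta> p (\<alpha> / \<delta>h)
     \<Longrightarrow> expansion_loop P l u \<gamma> \<delta>h x \<zeta> p \<alpha> \<alpha>"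
| expand: "sufficient_decrease P l u \<gamma> x \<zeta> p (\<alpha> / \<delta>h)
     \<Longrightarrow> expansion_loop P l u \<gamma> \<delta>h x \<zeta> p (\<alpha> / \<delta>h) \<alpha>'
     \<Longrightarrow> expansion_loop P l u \<gamma> \<delta>h x \<zeta> p \<alpha> \<alpha>'"

text \<open>Input/output relation of the procedure: on input \<open>(\<alpha>t, x, d, \<zeta>)\<close> it returns \<open>(\<alpha>, p)\<close>.\<close>

definition projected_extrapolation ::
    "(real^'n \<Rightarrow> real \<Rightarrow> real) \<Rightarrow> real^'n \<Rightarrow> real^'n \<Rightarrow> real \<Rightarrow> real
      \<Rightarrow> real \<Rightarrow> real^'n \<Rightarrow> real^'n \<Rightarrow> real \<Rightarrow> real \<Rightarrow> real^'n \<Rightarrow> bool" where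
  "projected_extrapolation P l u \<gamma> \<delta>h \<alpha>t x d \<zeta> \<alpha> p \<longleftrightarrow>
     (if sufficient_decrease P l u \<gamma> x \<zeta> d \<alpha>t
        then p = d \<and> expansion_loop P l u \<gamma> \<delta>h x \<zeta> d \<alpha>t \<alpha>
      else if sufficient_decrease P l u \<gamma> x \<zeta> (- d) \<alpha>t
        then p = - d \<and> expansion_loop P l u \<gamma> \<delta>h x \<zeta> (- d) \<alpha>t \<alpha>
      else \<alpha> = 0 \<and> p = d)"

definition alpha_min :: "real \<Rightarrow> real \<Rightarrow> real" where
  "alpha_min \<sigma> \<zeta>bar = root 3 (\<sigma> * \<zeta>bar)"

definition unsuccessful_update ::
    "real \<Rightarrow> real \<Rightarrow> real \<Rightarrow> real^'n \<Rightarrow> real \<Rightarrow> real \<Rightarrow> real^'n \<Rightarrow> real \<Rightarrow> real \<Rightarrow> bool" where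
  "unsuccessful_update \<theta> \<sigma> \<zeta>bar x \<alpha>t \<zeta> x' \<alpha>t' \<zeta>' \<longleftrightarrow>
     \<alpha>t' = max (alpha_min \<sigma> \<zeta>bar) (\<theta> * \<alpha>t) \<and>
     x' = x \<and>
     \<zeta>' = (if \<alpha>t' ^ 3 < \<zeta> then max \<zeta>bar (min (\<theta> * \<zeta>) (\<alpha>t' ^ 3)) else \<zeta>)"

definition successful_update ::
    "(real^'n \<Rightarrow> real \<Rightarrow> real) \<Rightarrow> real^'n \<Rightarrow> real^'n \<Rightarrow> real \<Rightarrow> real^'n
      \<Rightarrow> real^'n \<Rightarrow> real \<Rightarrow> real^'n \<Rightarrow> real \<Rightarrow> real \<Rightarrow> bool" where
  "successful_update P l u \<alpha> p x \<zeta> x' \<alpha>t' \<zeta>' \<longleftrightarrow>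
     \<alpha>t' = \<alpha> \<and>
     \<zeta>' = \<zeta> \<and>
     x' \<in> cbox l u \<and>
     P x' \<zeta> \<le> P (box_proj l u (x + \<alpha> *\<^sub>R p)) \<zeta>"

text \<open>The sequences \<open>x\<close> (iterates), \<open>\<alpha>t\<close> (tentative steps) and \<open>\<zeta>\<close> (accuracies) form a run of
  DFN-LLA along the directions \<open>d\<close>. The choices left open by the algorithm (\<open>\<zeta> 0\<close>, \<open>\<alpha>t 0\<close> and
  the new iterate after a success) are arbitrary.\<close>

definition dfn_lla_run ::
    "(real^'n \<Rightarrow> real \<Rightarrow> real) \<Rightarrow> real^'n \<Rightarrow> real^'n \<Rightarrow> real \<Rightarrow> real \<Rightarrow> real \<Rightarrow> real \<Rightarrow> real
      \<Rightarrow> (nat \<Rightarrow> real^'n) \<Rightarrow> (nat \<Rightarrow> real^'n) \<Rightarrow> (nat \<Rightarrow> real) \<Rightarrow> (nat \<Rightarrow> real) \<Rightarrow> bool" where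
  "dfn_lla_run P l u \<gamma> \<delta>h \<theta> \<sigma> \<zeta>bar d x \<alpha>t \<zeta> \<longleftrightarrow>
     x 0 \<in> cbox l u \<and> \<zeta> 0 \<ge> \<zeta>bar \<and> \<alpha>t 0 \<ge> root 3 (\<zeta> 0) \<and>
     (\<forall>k. \<exists>\<alpha> p. projected_extrapolation P l u \<gamma> \<delta>h (\<alpha>t k) (x k) (d k) (\<zeta> k) \<alpha> p \<and>
        (if \<alpha> > 0
         then successful_update P l u \<alpha> p (x k) (\<zeta> k) (x (Suc k)) (\<alpha>t (Suc k)) (\<zeta> (Suc k))
         else unsuccessful_update \<theta> \<sigma> \<zeta>bar (x k) (\<alpha>t k) (\<zeta> k)
                (x (Suc k)) (\<alpha>t (Suc k)) (\<zeta> (Suc k))))"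

definition dense_in_sphere :: "(nat \<Rightarrow> real^'n) \<Rightarrow> bool" where
  "dense_in_sphere d \<longleftrightarrow> (\<forall>e \<in> sphere 0 1. \<forall>\<epsilon>>0. \<exists>k. norm (d k - e) \<le> \<epsilon>)"

definition feasible_cone :: "real^'n \<Rightarrow> real^'n \<Rightarrow> real^'n \<Rightarrow> (real^'n) set" where
  "feasible_cone l u x =
     {d. \<forall>i. (x $ i = l $ i \<longrightarrow> d $ i \<ge> 0) \<and> (x $ i = u $ i \<longrightarrow> d $ i \<le> 0)}"

definition clarke_deriv :: "(real^'n \<Rightarrow> real) \<Rightarrow> real^'n \<Rightarrow> real^'n \<Rightarrow> ereal" where
  "clarke_deriv g xbar d =
     Limsup (nhds xbar \<times>\<^sub>F at_right 0) (\<lambda>(x, t). ereal ((g (x + t *\<^sub>R d) - g x) / t))"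

definition clarke_subdiff :: "(real^'n \<Rightarrow> real) \<Rightarrow> real^'n \<Rightarrow> (real^'n) set" where
  "clarke_subdiff g xbar = {\<xi>. \<forall>d. clarke_deriv g xbar d \<ge> ereal (\<xi> \<bullet> d)}"

definition goldstein_stationary ::
    "(real^'n \<Rightarrow> real) \<Rightarrow> real^'n \<Rightarrow> real^'n \<Rightarrow> real \<Rightarrow> real \<Rightarrow> real^'n \<Rightarrow> bool" where
  "goldstein_stationary g l u \<delta> \<epsilon> xbar \<longleftrightarrow>
     \<delta> > 0 \<and> \<epsilon> > 0 \<and> xbar \<in> cbox l u \<and>
     (\<exists>xt \<in> cball xbar \<delta> \<inter> cbox l u. \<exists>\<xi> \<in> clarke_subdiff g xt.
        \<forall>d \<in> feasible_cone l u xt \<inter> sphere 0 1. \<xi> \<bullet> d \<ge> - \<epsilon>)"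

end

theory Submission
  imports Defs
begin

text \<open>
  With \<open>\<zeta>bar > 0\<close> the tentative step never falls below \<open>a = alpha_min \<sigma> \<zeta>bar > 0\<close>. The accuracy can
  change only finitely often, and under a fixed accuracy every success lowers the perturbed objective
  by at least \<open>\<gamma> a\<^sup>2\<close>, while that objective is bounded below on the box. So from some point on all
  iterations fail, the iterate no longer moves, the tentative step is \<open>a\<close> and the accuracy is
  \<open>\<zeta>bar\<close> (\<open>run_stalls\<close>).

  At the final iterate \<open>xbar\<close> the polls then fail in both signs of all later directions, all with the
  same step and accuracy. These directions are still dense up to sign, and the perturbed objective is
  within \<open>L_F \<zeta>bar\<close> of the true objective \<open>g\<close>, so continuity gives \<open>g z \<ge> g xbar - \<eta>\<close> for all
  feasible \<open>z\<close> at distance exactly \<open>a\<close> from \<open>xbar\<close>, with \<open>\<eta> = \<gamma> a\<^sup>2 + 2 L_F \<zeta>bar\<close>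
  (\<open>sphere_values_if_polls_fail\<close>).

  Finally, minimise \<open>g\<close> plus the quadratic penalty \<open>(2 \<eta> / a\<^sup>2) \<parallel>z - xbar\<parallel>\<^sup>2\<close> over the feasible part
  of the closed \<open>a\<close>-ball around \<open>xbar\<close>. On the sphere the penalty outweighs \<open>\<eta>\<close>, so the minimiser is
  interior, and there the Clarke derivative of \<open>g\<close> along feasible directions is bounded below by a
  linear form of norm at most \<open>4 \<eta> / a\<close>, the claimed \<open>\<epsilon>\<close>. A separation argument turns this
  form into a Clarke subgradient (\<open>clarke_subgradient_sandwich\<close>,
  \<open>goldstein_stationary_if_sphere_values\<close>).
\<close>

section \<open>Clarke subgradients of Lipschitz functions\<close>

text \<open>This set is the epigraph of \<open>clarke_deriv g x\<close> up to boundary points. Working with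
  it instead of with the extended-real \<open>limsup\<close> makes sublinearity a statement about real
  inequalities that hold eventually.\<close>
definition clarke_majorants :: "(real^'n \<Rightarrow> real) \<Rightarrow> real^'n \<Rightarrow> ((real^'n) \<times> real) set" where
  "clarke_majorants g x =
     {(w, r). \<forall>\<^sub>F (z, t) in nhds x \<times>\<^sub>F at_right 0. g (z + t *\<^sub>R w) - g z \<le> r * t}"

lemma eventually_step_pos:
  "\<forall>\<^sub>F (z, t) in F \<times>\<^sub>F at_right (0::real). 0 < t"
  using eventually_compose_filterlim[OF eventually_at_right_less[of "0::real"] filterlim_snd]
  by (simp add: case_prod_unfold)

lemma clarke_deriv_le_majorant:
  assumes "(w, r) \<in> clarke_majorants g x"
  shows "clarke_deriv g x w \<le> ereal r"
proof -
  have "\<forall>\<^sub>F (z, t) in nhds x \<times>\<^sub>F at_right 0. g (z + t *\<^sub>R w) - g z \<le> r * t"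
    using assms by (simp add: clarke_majorants_def)
  with eventually_step_pos[of "nhds x"]
  have "\<forall>\<^sub>F p in nhds x \<times>\<^sub>F at_right 0.
      (case p of (z, t) \<Rightarrow> ereal ((g (z + t *\<^sub>R w) - g z) / t)) \<le> ereal r"
    by eventually_elim (auto simp: divide_simps mult.commute)
  then show ?thesis
    unfolding clarke_deriv_def by (rule Limsup_bounded)
qed

lemma majorant_if_clarke_deriv_less:
  assumes "clarke_deriv g x w < ereal r"
  shows "(w, r) \<in> clarke_majorants g x"
proof -
  have "\<forall>\<^sub>F p in nhds x \<times>\<^sub>F at_right 0.
      (case p of (z, t) \<Rightarrow> ereal ((g (z + t *\<^sub>R w) - g z) / t)) < ereal r"
    using assms unfolding clarke_deriv_def by (rule Limsup_lessD)
  with eventually_step_pos[of "nhds x"]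
  have "\<forall>\<^sub>F (z, t) in nhds x \<times>\<^sub>F at_right 0. g (z + t *\<^sub>R w) - g z \<le> r * t"
    by eventually_elim (auto simp: divide_simps mult.commute)
  then show ?thesis by (simp add: clarke_majorants_def)
qed

text \<open>The increment along \<open>w1 + w2\<close> is the increment along \<open>w1\<close> from \<open>z\<close> plus the increment along
  \<open>w2\<close> from \<open>z + t w1\<close>. The base point of the second one still tends to \<open>x\<close>; this is where it
  matters that the Clarke derivative lets the base point move.\<close>
lemma clarke_majorants_add:
  assumes "(w1, r1) \<in> clarke_majorants g x" "(w2, r2) \<in> clarke_majorants g x"
  shows "(w1 + w2, r1 + r2) \<in> clarke_majorants g x"
proof -
  let ?F = "nhds x \<times>\<^sub>F at_right (0::real)"
  have snd0: "((\<lambda>p. snd p) \<longlongrightarrow> 0) ?F"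
    using filterlim_mono[OF filterlim_snd] by (metis at_within_le_nhds order_refl)
  have "((\<lambda>p. fst p + snd p *\<^sub>R w1) \<longlongrightarrow> x + 0 *\<^sub>R w1) ?F"
    by (intro tendsto_intros snd0 filterlim_fst)
  then have lim: "filterlim (\<lambda>p. (fst p + snd p *\<^sub>R w1, snd p)) ?F ?F"
    by (intro filterlim_Pair filterlim_snd) simp
  have e1: "\<forall>\<^sub>F p in ?F. g (fst p + snd p *\<^sub>R w1) - g (fst p) \<le> r1 * snd p"
    using assms(1) by (simp add: clarke_majorants_def case_prod_unfold)
  have "\<forall>\<^sub>F p in ?F. g (fst p + snd p *\<^sub>R w2) - g (fst p) \<le> r2 * snd p"
    using assms(2) by (simp add: clarke_majorants_def case_prod_unfold)
  from eventually_compose_filterlim[OF this lim] e1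
  have "\<forall>\<^sub>F p in ?F. g (fst p + snd p *\<^sub>R (w1 + w2)) - g (fst p) \<le> (r1 + r2) * snd p"
    by eventually_elim (simp add: algebra_simps)
  then show ?thesis by (simp add: clarke_majorants_def case_prod_unfold)
qed

lemma clarke_majorants_scale:
  assumes "(w, r) \<in> clarke_majorants g x" "0 < c"
  shows "(c *\<^sub>R w, c * r) \<in> clarke_majorants g x"
proof -
  let ?F = "nhds x \<times>\<^sub>F at_right (0::real)"
  have "filterlim (\<lambda>t. c * t) (at_right 0) (at_right (0::real))"
    using filterlim_times_pos[OF filterlim_ident \<open>0 < c\<close>, of "0::real"] by simp
  then have lim: "filterlim (\<lambda>p. (fst p, c * snd p)) ?F ?F"
    by (intro filterlim_Pair filterlim_fst filterlim_compose[OF _ filterlim_snd])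
  have "\<forall>\<^sub>F p in ?F. g (fst p + snd p *\<^sub>R w) - g (fst p) \<le> r * snd p"
    using assms(1) by (simp add: clarke_majorants_def case_prod_unfold)
  from eventually_compose_filterlim[OF this lim]
  have "\<forall>\<^sub>F p in ?F. g (fst p + snd p *\<^sub>R (c *\<^sub>R w)) - g (fst p) \<le> (c * r) * snd p"
    by eventually_elim (simp add: algebra_simps)
  then show ?thesis by (simp add: clarke_majorants_def case_prod_unfold)
qed

lemma convex_clarke_majorants: "convex (clarke_majorants g x)"
proof (unfold convex_alt, intro ballI allI impI)
  fix p q :: "(real^'a) \<times> real" and s :: real
  assume p: "p \<in> clarke_majorants g x" and q: "q \<in> clarke_majorants g x" and s: "0 \<le> s \<and> s \<le> 1"
  consider "s = 0" | "s = 1" | "0 < s" "0 < 1 - s" using s by force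
  then show "(1 - s) *\<^sub>R p + s *\<^sub>R q \<in> clarke_majorants g x"
  proof cases
    case 3
    have "((1 - s) *\<^sub>R fst p, (1 - s) * snd p) \<in> clarke_majorants g x"
      using clarke_majorants_scale[OF _ 3(2)] p by (metis prod.collapse)
    moreover have "(s *\<^sub>R fst q, s * snd q) \<in> clarke_majorants g x"
      using clarke_majorants_scale[OF _ 3(1)] q by (metis prod.collapse)
    ultimately have "((1 - s) *\<^sub>R fst p + s *\<^sub>R fst q, (1 - s) * snd p + s * snd q)
        \<in> clarke_majorants g x"
      by (rule clarke_majorants_add)
    then show ?thesis by (simp add: plus_prod_def scaleR_prod_def)
  qed (use p q in auto)
qed

lemma lipschitz_clarke_majorant:
  assumes "L-lipschitz_on UNIV g"
  shows "(w, L * norm w) \<in> clarke_majorants g x"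
proof -
  have "\<forall>\<^sub>F (z, t) in nhds x \<times>\<^sub>F at_right 0. g (z + t *\<^sub>R w) - g z \<le> L * norm w * t"
    using eventually_step_pos[of "nhds x"]
  proof (eventually_elim, clarify)
    fix z and t :: real assume "0 < t"
    then show "g (z + t *\<^sub>R w) - g z \<le> L * norm w * t"
      using lipschitz_onD[OF assms, of "z + t *\<^sub>R w" z] by (simp add: dist_norm mult_ac)
  qed
  then show ?thesis by (simp add: clarke_majorants_def)
qed

text \<open>A sandwich theorem: a linear form lying below the sublinear function \<open>clarke_deriv g x\<close> on a convex
  cone \<open>D\<close> can be replaced by a linear form that lies below it everywhere, that is, a subgradient,
  without decreasing on \<open>D\<close>. The subgradient is the slope of a hyperplane that separates the
  majorants from the strict hypograph of \<open>v\<close> over \<open>D\<close>; the Lipschitz bound keeps this hyperplane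
  from being vertical.\<close>
lemma clarke_subgradient_sandwich:
  fixes g :: "real^'n \<Rightarrow> real"
  assumes lip: "L-lipschitz_on UNIV g"
    and D: "convex_cone D"
    and below: "\<And>d. d \<in> D \<Longrightarrow> ereal (v \<bullet> d) \<le> clarke_deriv g x d"
  shows "\<exists>\<xi>\<in>clarke_subdiff g x. \<forall>d\<in>D. v \<bullet> d \<le> \<xi> \<bullet> d"
proof -
  let ?A = "clarke_majorants g x"
  let ?B = "{(d, s). d \<in> D \<and> s < v \<bullet> d} :: ((real^'n) \<times> real) set"
  have zero: "0 \<in> D" using D by (simp add: convex_cone_contains_0)
  have "convex ?B"
  proof (rule convexI)
    fix p q and a b :: real
    assume p: "p \<in> ?B" and q: "q \<in> ?B" and ab: "0 \<le> a" "0 \<le> b" "a + b = 1"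
    have "a *\<^sub>R fst p + b *\<^sub>R fst q \<in> D"
      using D p q ab by (auto intro!: convex_cone_add convex_cone_scaleR)
    moreover have "a * snd p + b * snd q < a * (v \<bullet> fst p) + b * (v \<bullet> fst q)"
    proof (cases "a = 0")
      case False
      then show ?thesis
        using p q ab by (intro add_less_le_mono mult_strict_left_mono mult_left_mono) auto
    qed (use p q ab in auto)
    ultimately show "a *\<^sub>R p + b *\<^sub>R q \<in> ?B"
      by (simp add: case_prod_unfold inner_add_right)
  qed
  moreover have "?B \<inter> ?A = {}"
  proof (intro equals0I, clarify)
    fix d s assume "(d, s) \<in> ?A" and d: "d \<in> D" "s < v \<bullet> d"
    then have "ereal (v \<bullet> d) \<le> ereal s"
      using below[OF d(1)] clarke_deriv_le_majorant order_trans by blast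
    then show False using d(2) by simp
  qed
  moreover have "?A \<noteq> {}" using lipschitz_clarke_majorant[OF lip] by blast
  moreover have "(0, -1) \<in> ?B" using zero by simp
  then have "?B \<noteq> {}" by blast
  ultimately obtain n \<beta> where n: "n \<noteq> 0" and nB: "\<And>q. q \<in> ?B \<Longrightarrow> n \<bullet> q \<le> \<beta>"
    and nA: "\<And>q. q \<in> ?A \<Longrightarrow> \<beta> \<le> n \<bullet> q"
    using separating_hyperplane_sets[of ?B ?A] convex_clarke_majorants by blast
  define \<eta> \<tau> where "\<eta> = fst n" and "\<tau> = snd n"
  have nB': "\<eta> \<bullet> d + \<tau> * s \<le> \<beta>" if "d \<in> D" "s < v \<bullet> d" for d s
    using nB[of "(d, s)"] that by (simp add: \<eta>_def \<tau>_def inner_prod_def)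
  have nA': "\<beta> \<le> \<eta> \<bullet> w + \<tau> * r" if "(w, r) \<in> ?A" for w r
    using nA[OF that] by (simp add: \<eta>_def \<tau>_def inner_prod_def)
  have "(0, 0) \<in> ?A" using lipschitz_clarke_majorant[OF lip, of 0] by simp
  then have \<beta>0: "\<beta> \<le> 0" using nA' by fastforce
  \<comment> \<open>The origin lies in the closure of both sets, so the separating hyperplane will pass through it.\<close>
  have "- \<tau> \<le> \<beta>" using nB'[of 0 "-1"] zero by simp
  then have \<tau>0: "0 \<le> \<tau>" using \<beta>0 by simp
  \<comment> \<open>Every \<open>w\<close> has a majorant, so a vertical hyperplane would bound the linear form \<open>\<eta>\<close> below.\<close>
  have \<tau>: "0 < \<tau>"
  proof (rule ccontr)
    assume "\<not> 0 < \<tau>"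
    then have "\<tau> = 0" using \<tau>0 by simp
    then have "\<beta> \<ge> 0" using nB'[of 0 "-1"] zero by simp
    have "0 \<le> \<eta> \<bullet> (- \<eta>)"
      using nA'[OF lipschitz_clarke_majorant[OF lip, of "- \<eta>"]] \<open>\<tau> = 0\<close> \<open>\<beta> \<ge> 0\<close> by simp
    then have "\<eta> = 0" by (simp flip: power2_norm_eq_inner)
    then show False using n \<open>\<tau> = 0\<close> by (simp add: \<eta>_def \<tau>_def prod_eq_iff)
  qed
  have "\<beta> \<ge> 0"
  proof (rule field_le_epsilon)
    fix e :: real assume "0 < e"
    then show "0 \<le> \<beta> + e" using nB'[of 0 "- (e / \<tau>)"] zero \<tau> by simp
  qed
  then have \<beta>: "\<beta> = 0" using \<beta>0 by simp
  define \<xi> where "\<xi> = - (1 / \<tau>) *\<^sub>R \<eta>"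
  have \<eta>: "\<eta> \<bullet> w = - \<tau> * (\<xi> \<bullet> w)" for w using \<tau> by (simp add: \<xi>_def)
  have upper: "\<xi> \<bullet> w \<le> r" if "(w, r) \<in> ?A" for w r
    using nA'[OF that] \<tau> unfolding \<beta> \<eta> by simp
  have "ereal (\<xi> \<bullet> w) \<le> clarke_deriv g x w" for w
  proof (rule ccontr)
    assume "\<not> ?thesis"
    then have "clarke_deriv g x w < ereal (\<xi> \<bullet> w)" by (simp add: not_le)
    then obtain r where "clarke_deriv g x w < ereal r" "r < \<xi> \<bullet> w"
      using ereal_dense2[of "clarke_deriv g x w" "ereal (\<xi> \<bullet> w)"] by auto
    then show False using upper[OF majorant_if_clarke_deriv_less] by force
  qed
  moreover have "v \<bullet> d \<le> \<xi> \<bullet> d" if "d \<in> D" for d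
  proof (rule dense_le)
    fix s assume "s < v \<bullet> d"
    then show "s \<le> \<xi> \<bullet> d" using nB'[OF that] \<tau> unfolding \<beta> \<eta> by fastforce
  qed
  ultimately show ?thesis by (auto simp: clarke_subdiff_def)
qed

text \<open>Keeping the base point fixed only decreases the \<open>limsup\<close>, so difference quotients at
  \<open>x\<close> itself bound the Clarke derivative from below.\<close>
lemma clarke_deriv_ge_one_sided:
  assumes "(h \<longlongrightarrow> m) (at_right 0)"
    and "\<forall>\<^sub>F t in at_right 0. h t * t \<le> g (x + t *\<^sub>R w) - g x"
  shows "ereal m \<le> clarke_deriv g x w"
proof (rule ccontr)
  assume "\<not> ?thesis"
  then have "clarke_deriv g x w < ereal m" by (simp add: not_le)
  then obtain r where r: "clarke_deriv g x w < ereal r" "r < m"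
    using ereal_dense2[of "clarke_deriv g x w" "ereal m"] by auto
  have "\<forall>\<^sub>F p in nhds x \<times>\<^sub>F at_right 0. g (fst p + snd p *\<^sub>R w) - g (fst p) \<le> r * snd p"
    using majorant_if_clarke_deriv_less[OF r(1)] by (simp add: clarke_majorants_def case_prod_unfold)
  moreover have "filterlim (\<lambda>t. (x, t)) (nhds x \<times>\<^sub>F at_right 0) (at_right (0::real))"
    by (intro filterlim_Pair filterlim_ident tendsto_const)
  ultimately have "\<forall>\<^sub>F t in at_right 0. g (x + t *\<^sub>R w) - g x \<le> r * t"
    using eventually_compose_filterlim by fastforce
  moreover have "\<forall>\<^sub>F t in at_right 0. r < h t"
    using order_tendstoD(1)[OF assms(1) r(2)] .
  ultimately have "\<forall>\<^sub>F t in at_right (0::real). False"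
    using assms(2) eventually_at_right_less[of "0::real"]
  proof eventually_elim
    case (elim t)
    then have "r * t < h t * t" by simp
    then show False using elim by linarith
  qed
  then show False by (simp add: trivial_limit_at_right_real)
qed

section \<open>A sufficient condition for Goldstein stationarity on a box\<close>

lemma convex_cone_feasible_cone: "convex_cone (feasible_cone l u x)"
  by (auto simp: convex_cone_iff feasible_cone_def mult_nonneg_nonpos add_nonpos_nonpos)

lemma eventually_feasible_step:
  fixes x :: "real^'n"
  assumes x: "x \<in> cbox l u" and d: "d \<in> feasible_cone l u x"
  shows "\<forall>\<^sub>F t in at_right 0. x + t *\<^sub>R d \<in> cbox l u"
proof -
  have lim: "((\<lambda>t. x $ i + t * d $ i) \<longlongrightarrow> x $ i) (at_right 0)" for i
    by (auto intro!: tendsto_eq_intros)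
  have pos: "\<forall>\<^sub>F t in at_right (0::real). 0 < t" by (rule eventually_at_right_less)
  have "\<forall>\<^sub>F t in at_right 0. l $ i \<le> x $ i + t * d $ i" for i
  proof (cases "x $ i = l $ i")
    case True
    then show ?thesis using d pos by (auto simp: feasible_cone_def elim!: eventually_mono)
  next
    case False
    then have "l $ i < x $ i" using x by (simp add: mem_box_cart order_less_le)
    from order_tendstoD(1)[OF lim this] show ?thesis by (rule eventually_mono) simp
  qed
  moreover have "\<forall>\<^sub>F t in at_right 0. x $ i + t * d $ i \<le> u $ i" for i
  proof (cases "x $ i = u $ i")
    case True
    then show ?thesis using d pos
      by (auto simp: feasible_cone_def mult_nonneg_nonpos elim!: eventually_mono)
  next
    case False
    then have "x $ i < u $ i" using x by (simp add: mem_box_cart order_less_le)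
    from order_tendstoD(2)[OF lim this] show ?thesis by (rule eventually_mono) simp
  qed
  ultimately have "\<forall>\<^sub>F t in at_right 0. \<forall>i. l $ i \<le> x $ i + t * d $ i \<and> x $ i + t * d $ i \<le> u $ i"
    by (intro eventually_all_finite eventually_conj)
  then show ?thesis by (simp add: mem_box_cart)
qed

text \<open>If \<open>g\<close> falls by at most \<open>\<eta>\<close> from \<open>xbar\<close> to the sphere of radius \<open>a\<close>, then adding a quadratic
  penalty that reaches more than \<open>\<eta>\<close> on that sphere forces the minimiser \<open>xt\<close> over the ball into
  its interior. There only the box constrains \<open>xt\<close>, so the first-order condition yields a
  subgradient of \<open>g\<close> that balances the gradient of the penalty on the feasible cone, and this
  gradient has norm at most \<open>\<epsilon>\<close>.\<close>
lemma goldstein_stationary_if_sphere_values: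
  fixes g :: "real^'n \<Rightarrow> real"
  assumes lip: "L-lipschitz_on UNIV g" and xbar: "xbar \<in> cbox l u"
    and a: "0 < a" and \<epsilon>: "0 < \<epsilon>" and slack: "2 * \<eta> < \<epsilon> * a"
    and sphere: "\<And>z. z \<in> cbox l u \<Longrightarrow> norm (z - xbar) = a \<Longrightarrow> g xbar - \<eta> \<le> g z"
  shows "goldstein_stationary g l u a \<epsilon> xbar"
proof -
  \<comment> \<open>The largest weight for which the penalty gradient \<open>2 c (z - xbar)\<close> stays within \<open>\<epsilon>\<close> on the ball.\<close>
  define c where "c = \<epsilon> / (2 * a)"
  define \<psi> where "\<psi> z = g z + c * (norm (z - xbar))\<^sup>2" for z
  have c: "0 < c" "2 * c * a = \<epsilon>" using a \<epsilon> by (simp_all add: c_def)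
  have "\<eta> < c * a\<^sup>2" using slack a by (simp add: c_def power2_eq_square field_simps)
  have "continuous_on (cball xbar a \<inter> cbox l u) \<psi>"
    unfolding \<psi>_def
    by (intro continuous_intros continuous_on_subset[OF lipschitz_on_continuous_on[OF lip]]) auto
  then obtain xt where xt: "xt \<in> cball xbar a" "xt \<in> cbox l u"
    and min: "\<And>z. z \<in> cball xbar a \<Longrightarrow> z \<in> cbox l u \<Longrightarrow> \<psi> xt \<le> \<psi> z"
    using continuous_attains_inf[of "cball xbar a \<inter> cbox l u" \<psi>] xbar a
    by (metis IntE IntI compact_Int compact_cball compact_cbox centre_in_cball empty_iff less_imp_le)
  have "norm (xt - xbar) \<noteq> a"
  proof
    assume *: "norm (xt - xbar) = a"
    have "\<psi> xt \<le> \<psi> xbar" using min[of xbar] xbar a by simp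
    then show False using sphere[OF xt(2) *] \<open>\<eta> < c * a\<^sup>2\<close> by (simp add: \<psi>_def *)
  qed
  then have inner: "norm (xt - xbar) < a" using xt(1) by (simp add: dist_norm norm_minus_commute)
  define v where "v = - (2 * c) *\<^sub>R (xt - xbar)"
  have "ereal (v \<bullet> d) \<le> clarke_deriv g xt d" if d: "d \<in> feasible_cone l u xt" for d
  proof (rule clarke_deriv_ge_one_sided)
    show "((\<lambda>t. v \<bullet> d - c * (norm d)\<^sup>2 * t) \<longlongrightarrow> v \<bullet> d) (at_right 0)"
      by (auto intro!: tendsto_eq_intros)
    have "((\<lambda>t. norm (xt + t *\<^sub>R d - xbar)) \<longlongrightarrow> norm (xt - xbar)) (at_right 0)"
      by (auto intro!: tendsto_eq_intros)
    from order_tendstoD(2)[OF this inner] eventually_feasible_step[OF xt(2) d]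
    show "\<forall>\<^sub>F t in at_right 0. (v \<bullet> d - c * (norm d)\<^sup>2 * t) * t \<le> g (xt + t *\<^sub>R d) - g xt"
    proof eventually_elim
      case (elim t)
      then have "\<psi> xt \<le> \<psi> (xt + t *\<^sub>R d)"
        by (intro min) (simp_all add: dist_norm norm_minus_commute)
      moreover have "(norm (xt + t *\<^sub>R d - xbar))\<^sup>2
          = (norm (xt - xbar))\<^sup>2 + 2 * t * ((xt - xbar) \<bullet> d) + t\<^sup>2 * (norm d)\<^sup>2"
        unfolding power2_norm_eq_inner by (simp add: algebra_simps inner_commute power2_eq_square)
      ultimately have "g xt + c * (norm (xt - xbar))\<^sup>2 \<le> g (xt + t *\<^sub>R d)
          + c * ((norm (xt - xbar))\<^sup>2 + 2 * t * ((xt - xbar) \<bullet> d) + t\<^sup>2 * (norm d)\<^sup>2)"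
        by (simp only: \<psi>_def)
      moreover have "v \<bullet> d = - (2 * c) * ((xt - xbar) \<bullet> d)" by (simp add: v_def)
      ultimately show ?case by (simp only:) (simp add: distrib_left right_diff_distrib power2_eq_square mult_ac)
    qed
  qed
  then obtain \<xi> where \<xi>: "\<xi> \<in> clarke_subdiff g xt" "\<And>d. d \<in> feasible_cone l u xt \<Longrightarrow> v \<bullet> d \<le> \<xi> \<bullet> d"
    using clarke_subgradient_sandwich[OF lip convex_cone_feasible_cone] by blast
  have "- \<epsilon> \<le> \<xi> \<bullet> d" if "d \<in> feasible_cone l u xt" "norm d = 1" for d
  proof -
    have "norm v = 2 * c * norm (xt - xbar)" using c by (simp add: v_def)
    also have "\<dots> \<le> 2 * c * a" using c(1) inner by (intro mult_left_mono) auto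
    finally have "norm v \<le> \<epsilon>" using c by simp
    then have "- \<epsilon> \<le> v \<bullet> d" using Cauchy_Schwarz_ineq2[of v d] that(2) by simp
    then show ?thesis using \<xi>(2)[OF that(1)] by simp
  qed
  then have "\<forall>d\<in>feasible_cone l u xt \<inter> sphere 0 1. - \<epsilon> \<le> \<xi> \<bullet> d" by simp
  then show ?thesis
    unfolding goldstein_stationary_def using a \<epsilon> xbar xt \<xi>(1)
    by (intro conjI bexI[of _ xt] bexI[of _ \<xi>]) simp_all
qed

section \<open>Eventually constant sequences\<close>

text \<open>Used to show that an event happens only finitely often: let it force a fixed decrease of a
  decreasing quantity that is bounded below.\<close>
lemma eventually_drop_less:
  fixes X :: "nat \<Rightarrow> real"
  assumes "\<And>k. K \<le> k \<Longrightarrow> X (Suc k) \<le> X k" "\<And>k. K \<le> k \<Longrightarrow> B \<le> X k" "0 < e"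
  shows "\<forall>\<^sub>F k in sequentially. X k - X (Suc k) < e"
proof -
  define Y where "Y n = X (n + K)" for n
  have "decseq Y" by (rule decseq_SucI) (simp add: Y_def assms(1))
  moreover have "\<forall>n. B \<le> Y n" by (simp add: Y_def assms(2))
  ultimately obtain L where L: "Y \<longlonglongrightarrow> L" using decseq_convergent by blast
  have "(\<lambda>n. Y n - Y (Suc n)) \<longlonglongrightarrow> L - L"
    by (intro tendsto_diff L LIMSEQ_Suc)
  then have "\<forall>\<^sub>F n in sequentially. Y n - Y (Suc n) < e"
    using \<open>0 < e\<close> by (intro order_tendstoD(2)) simp_all
  then show ?thesis
    unfolding Y_def using eventually_sequentially_seg[of "\<lambda>k. X k - X (Suc k) < e" K] by simp
qed

lemma eventually_constant:
  assumes "\<forall>\<^sub>F k in sequentially. X (Suc k) = X k"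
  shows "\<exists>c. \<forall>\<^sub>F k in sequentially. X k = c"
proof -
  obtain K where K: "\<And>k. K \<le> k \<Longrightarrow> X (Suc k) = X k"
    using assms by (auto simp: eventually_sequentially)
  have "X k = X K" if "K \<le> k" for k using that by (induction rule: dec_induct) (simp_all add: K)
  then show ?thesis by (auto simp: eventually_sequentially)
qed

lemma limit_points_of_eventually_constant:
  fixes x :: "nat \<Rightarrow> 'a::t2_space"
  assumes "\<forall>\<^sub>F k in sequentially. x k = c"
  shows "(\<exists>r :: nat \<Rightarrow> nat. strict_mono r \<and> (x \<circ> r) \<longlonglongrightarrow> z) \<longleftrightarrow> z = c"
proof
  assume "z = c"
  then show "\<exists>r :: nat \<Rightarrow> nat. strict_mono r \<and> (x \<circ> r) \<longlonglongrightarrow> z"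
    using tendsto_eventually[OF assms] by (intro exI[of _ id]) (simp add: strict_mono_id)
next
  assume "\<exists>r :: nat \<Rightarrow> nat. strict_mono r \<and> (x \<circ> r) \<longlonglongrightarrow> z"
  then obtain r :: "nat \<Rightarrow> nat" where r: "strict_mono r" "(x \<circ> r) \<longlonglongrightarrow> z" by blast
  from LIMSEQ_subseq_LIMSEQ[OF tendsto_eventually[OF assms] r(1)] r(2)
  show "z = c" by (metis LIMSEQ_unique)
qed

section \<open>Runs with positive final accuracy stall\<close>

lemma expansion_loop_decrease:
  assumes "expansion_loop P l u \<gamma> \<delta>h x \<zeta> p \<alpha> \<alpha>'"
    and "0 < \<alpha>" "\<delta>h \<in> {0<..<1}" "sufficient_decrease P l u \<gamma> x \<zeta> p \<alpha>"
  shows "\<alpha> \<le> \<alpha>' \<and> sufficient_decrease P l u \<gamma> x \<zeta> p \<alpha>'"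
  using assms
proof induction
  case (expand \<alpha> \<alpha>')
  then have "\<alpha> \<le> \<alpha> / \<delta>h" by (simp add: pos_le_divide_eq)
  with expand show ?case by auto
qed simp

locale positive_accuracy_run =
  fixes P :: "real^'n \<Rightarrow> real \<Rightarrow> real" and l u :: "real^'n"
    and \<gamma> \<delta>h \<theta> \<sigma> \<zeta>bar :: real and d x :: "nat \<Rightarrow> real^'n" and \<alpha>t \<zeta> :: "nat \<Rightarrow> real"
  assumes \<gamma>: "0 < \<gamma>" and \<delta>h: "\<delta>h \<in> {0<..<1}" and \<theta>: "\<theta> \<in> {0<..<1}" and \<sigma>: "\<sigma> \<in> {0<..<1}"
    and \<zeta>bar: "0 < \<zeta>bar"
    and run: "dfn_lla_run P l u \<gamma> \<delta>h \<theta> \<sigma> \<zeta>bar d x \<alpha>t \<zeta>"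
    and bounded_below: "\<And>w. 0 < w \<Longrightarrow> \<exists>B. \<forall>z\<in>cbox l u. B \<le> P z w"
begin

abbreviation "a \<equiv> alpha_min \<sigma> \<zeta>bar"

lemma alpha_min_pos: "0 < a"
  using \<sigma> \<zeta>bar by (simp add: alpha_min_def)

lemma alpha_min_cubed: "a ^ 3 = \<sigma> * \<zeta>bar"
  using \<sigma> \<zeta>bar by (simp add: alpha_min_def real_root_pow_pos2)

text \<open>This records only the consequences of a success, for which the accepted step is the next
  tentative step, and so it is not the negation of \<open>unsuccessful\<close> below.\<close>
definition successful :: "nat \<Rightarrow> bool" where
  "successful k \<longleftrightarrow> \<alpha>t k \<le> \<alpha>t (Suc k) \<and> \<zeta> (Suc k) = \<zeta> k \<and> x (Suc k) \<in> cbox l u \<and>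
     P (x (Suc k)) (\<zeta> k) \<le> P (x k) (\<zeta> k) - \<gamma> * (\<alpha>t (Suc k))\<^sup>2"

definition unsuccessful :: "nat \<Rightarrow> bool" where
  "unsuccessful k \<longleftrightarrow>
     unsuccessful_update \<theta> \<sigma> \<zeta>bar (x k) (\<alpha>t k) (\<zeta> k) (x (Suc k)) (\<alpha>t (Suc k)) (\<zeta> (Suc k)) \<and>
     \<not> sufficient_decrease P l u \<gamma> (x k) (\<zeta> k) (d k) (\<alpha>t k) \<and>
     \<not> sufficient_decrease P l u \<gamma> (x k) (\<zeta> k) (- d k) (\<alpha>t k)"

lemma successful_or_unsuccessful:
  assumes pos: "0 < \<alpha>t k"
  shows "successful k \<or> unsuccessful k"
proof -
  obtain \<alpha> p where
    pe: "projected_extrapolation P l u \<gamma> \<delta>h (\<alpha>t k) (x k) (d k) (\<zeta> k) \<alpha> p" and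
    upd: "if \<alpha> > 0
         then successful_update P l u \<alpha> p (x k) (\<zeta> k) (x (Suc k)) (\<alpha>t (Suc k)) (\<zeta> (Suc k))
         else unsuccessful_update \<theta> \<sigma> \<zeta>bar (x k) (\<alpha>t k) (\<zeta> k)
                (x (Suc k)) (\<alpha>t (Suc k)) (\<zeta> (Suc k))"
    using run unfolding dfn_lla_run_def by blast
  show ?thesis
  proof (cases "sufficient_decrease P l u \<gamma> (x k) (\<zeta> k) (d k) (\<alpha>t k) \<or>
      sufficient_decrease P l u \<gamma> (x k) (\<zeta> k) (- d k) (\<alpha>t k)")
    case True
    then have "sufficient_decrease P l u \<gamma> (x k) (\<zeta> k) p (\<alpha>t k)"
      "expansion_loop P l u \<gamma> \<delta>h (x k) (\<zeta> k) p (\<alpha>t k) \<alpha>"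
      using pe unfolding projected_extrapolation_def by (auto split: if_splits)
    then have *: "\<alpha>t k \<le> \<alpha>" "sufficient_decrease P l u \<gamma> (x k) (\<zeta> k) p \<alpha>"
      using expansion_loop_decrease pos \<delta>h by blast+
    then have "successful_update P l u \<alpha> p (x k) (\<zeta> k) (x (Suc k)) (\<alpha>t (Suc k)) (\<zeta> (Suc k))"
      using upd pos by simp
    then show ?thesis
      using * by (auto simp: successful_def successful_update_def sufficient_decrease_def)
  next
    case False
    then have "\<alpha> = 0" using pe by (auto simp: projected_extrapolation_def)
    then show ?thesis using False upd by (simp add: unsuccessful_def)
  qed
qed

text \<open>The box, and the floors \<open>a\<close> and \<open>\<zeta>bar\<close> that the updates enforce, are invariant; initially
  \<open>\<sigma> < 1\<close> puts \<open>a\<close> below the cube root of \<open>\<zeta> 0\<close>.\<close>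
lemma run_bounds: "x k \<in> cbox l u \<and> a \<le> \<alpha>t k \<and> \<zeta>bar \<le> \<zeta> k"
proof (induction k)
  case 0
  have "x 0 \<in> cbox l u" "\<zeta>bar \<le> \<zeta> 0" "root 3 (\<zeta> 0) \<le> \<alpha>t 0"
    using run by (auto simp: dfn_lla_run_def)
  moreover have "\<sigma> * \<zeta>bar \<le> \<zeta>bar" using \<sigma> \<zeta>bar by simp
  then have "a \<le> root 3 (\<zeta> 0)"
    using \<open>\<zeta>bar \<le> \<zeta> 0\<close> by (simp add: alpha_min_def)
  ultimately show ?case by simp
next
  case (Suc k)
  then have "successful k \<or> unsuccessful k"
    using alpha_min_pos successful_or_unsuccessful by force
  then show ?case
    using Suc by (auto simp: successful_def unsuccessful_def unsuccessful_update_def)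
qed

lemma step: "successful k \<or> unsuccessful k"
  using run_bounds alpha_min_pos successful_or_unsuccessful by (meson less_le_trans)

lemma accuracy_step:
  "\<zeta> (Suc k) = \<zeta> k \<or> \<zeta> (Suc k) = \<zeta>bar \<or> \<zeta> (Suc k) \<le> \<theta> * \<zeta> k"
  using step[of k]
proof
  assume "unsuccessful k"
  then have "\<zeta> (Suc k) = \<zeta> k \<or> \<zeta> (Suc k) = max \<zeta>bar (min (\<theta> * \<zeta> k) (\<alpha>t (Suc k) ^ 3))"
    by (simp add: unsuccessful_def unsuccessful_update_def)
  then show ?thesis by linarith
qed (simp add: successful_def)

lemma accuracy_decreasing: "\<zeta> (Suc k) \<le> \<zeta> k"
proof -
  have "\<theta> * \<zeta> k \<le> \<zeta> k" using run_bounds[of k] \<zeta>bar \<theta> by (simp add: mult_left_le_one_le)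
  then show ?thesis using accuracy_step[of k] run_bounds[of k] by linarith
qed

text \<open>Each change that does not reach \<open>\<zeta>bar\<close> removes at least the fraction \<open>1 - \<theta>\<close> of an accuracy
  that is at least \<open>\<zeta>bar\<close>, so it can happen only finitely often.\<close>
lemma eventually_accuracy_constant: "\<exists>w. \<forall>\<^sub>F k in sequentially. \<zeta> k = w"
proof (cases "\<exists>K. \<zeta> K = \<zeta>bar")
  case True
  then obtain K where "\<zeta> K = \<zeta>bar" by blast
  moreover have "\<zeta> k \<le> \<zeta> K" if "K \<le> k" for k
    using that accuracy_decreasing by (rule lift_Suc_antimono_le[rotated])
  ultimately have "\<zeta> k = \<zeta>bar" if "K \<le> k" for k using run_bounds[of k] that by force
  then show ?thesis by (auto simp: eventually_sequentially)
next
  case False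
  have "\<forall>\<^sub>F k in sequentially. \<zeta> k - \<zeta> (Suc k) < (1 - \<theta>) * \<zeta>bar"
    using run_bounds \<theta> \<zeta>bar accuracy_decreasing by (intro eventually_drop_less[of 0 _ \<zeta>bar]) auto
  then have "\<forall>\<^sub>F k in sequentially. \<zeta> (Suc k) = \<zeta> k"
  proof eventually_elim
    case (elim k)
    have "(1 - \<theta>) * \<zeta>bar \<le> (1 - \<theta>) * \<zeta> k" using \<theta> run_bounds[of k] by simp
    then have "\<not> \<zeta> (Suc k) \<le> \<theta> * \<zeta> k" using elim by (simp add: algebra_simps)
    then show ?case using accuracy_step[of k] False by blast
  qed
  then show ?thesis by (rule eventually_constant)
qed

text \<open>Once the accuracy is fixed, all iterations use the same objective. Unsuccessful ones leave it
  unchanged and successful ones lower it by at least \<open>\<gamma> a\<^sup>2\<close>.\<close>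
lemma eventually_unsuccessful: "\<forall>\<^sub>F k in sequentially. unsuccessful k"
proof -
  obtain w K where w: "\<And>k. K \<le> k \<Longrightarrow> \<zeta> k = w"
    using eventually_accuracy_constant by (auto simp: eventually_sequentially)
  have "0 < w" using w[of K] run_bounds[of K] \<zeta>bar by simp
  then obtain B where B: "\<And>z. z \<in> cbox l u \<Longrightarrow> B \<le> P z w" using bounded_below by blast
  have drop: "P (x (Suc k)) w \<le> P (x k) w - \<gamma> * a\<^sup>2" if "K \<le> k" "successful k" for k
  proof -
    have "\<gamma> * a\<^sup>2 \<le> \<gamma> * (\<alpha>t (Suc k))\<^sup>2"
      using run_bounds[of "Suc k"] \<gamma> alpha_min_pos by (simp add: power_mono)
    then show ?thesis using that w by (simp add: successful_def)
  qed
  have pos: "0 < \<gamma> * a\<^sup>2" using \<gamma> alpha_min_pos by simp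
  have "P (x (Suc k)) w \<le> P (x k) w" if "K \<le> k" for k
    using step[of k] drop[OF that] pos
    by (auto simp: unsuccessful_def unsuccessful_update_def)
  then have "\<forall>\<^sub>F k in sequentially. P (x k) w - P (x (Suc k)) w < \<gamma> * a\<^sup>2"
    using run_bounds B pos by (intro eventually_drop_less[of K _ B]) auto
  with eventually_ge_at_top[of K] show ?thesis
  proof eventually_elim
    case (elim k)
    then show ?case using step[of k] drop[of k] by force
  qed
qed

lemma eventually_min_step: "\<forall>\<^sub>F k in sequentially. \<alpha>t k = a"
proof -
  obtain K where K: "\<And>k. K \<le> k \<Longrightarrow> \<alpha>t (Suc k) = max a (\<theta> * \<alpha>t k)"
    using eventually_unsuccessful
    by (auto simp: eventually_sequentially unsuccessful_def unsuccessful_update_def)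
  have "\<alpha>t (Suc k) \<le> \<alpha>t k" if "K \<le> k" for k
    using K[OF that] run_bounds[of k] alpha_min_pos \<theta> by (simp add: mult_left_le_one_le)
  then have "\<forall>\<^sub>F k in sequentially. \<alpha>t k - \<alpha>t (Suc k) < (1 - \<theta>) * a"
    using run_bounds \<theta> alpha_min_pos by (intro eventually_drop_less[of K _ a]) auto
  with eventually_ge_at_top[of K] have "\<forall>\<^sub>F k in sequentially. \<alpha>t (Suc k) = a"
  proof eventually_elim
    case (elim k)
    have "(1 - \<theta>) * a \<le> (1 - \<theta>) * \<alpha>t k" using \<theta> run_bounds[of k] by simp
    then have "\<alpha>t (Suc k) \<noteq> \<theta> * \<alpha>t k" using elim by (simp add: algebra_simps)
    then show ?case using K[OF elim(1)] by (simp add: max_def split: if_splits)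
  qed
  then show ?thesis using eventually_sequentially_Suc[of "\<lambda>k. \<alpha>t k = a"] by simp
qed

text \<open>The factor \<open>\<sigma> < 1\<close> makes \<open>a ^ 3\<close> smaller than every accuracy that occurs, so an unsuccessful
  iteration with tentative step \<open>a\<close> always triggers the accuracy update, and the cap by
  \<open>a ^ 3 < \<zeta>bar\<close> sends it to \<open>\<zeta>bar\<close> at once.\<close>
lemma eventually_final_accuracy: "\<forall>\<^sub>F k in sequentially. \<zeta> k = \<zeta>bar"
proof -
  have "\<forall>\<^sub>F k in sequentially. \<alpha>t (Suc k) = a"
    using eventually_min_step eventually_sequentially_Suc[of "\<lambda>k. \<alpha>t k = a"] by simp
  with eventually_unsuccessful have "\<forall>\<^sub>F k in sequentially. \<zeta> (Suc k) = \<zeta>bar"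
  proof eventually_elim
    case (elim k)
    have "a ^ 3 < \<zeta>bar" using alpha_min_cubed \<sigma> \<zeta>bar by simp
    then show ?case
      using elim run_bounds[of k] by (auto simp: unsuccessful_def unsuccessful_update_def)
  qed
  then show ?thesis using eventually_sequentially_Suc[of "\<lambda>k. \<zeta> k = \<zeta>bar"] by simp
qed

lemma run_stalls:
  obtains xbar where "xbar \<in> cbox l u" "\<forall>\<^sub>F k in sequentially. x k = xbar"
    "\<forall>\<^sub>F k in sequentially. \<not> sufficient_decrease P l u \<gamma> xbar \<zeta>bar (d k) a
      \<and> \<not> sufficient_decrease P l u \<gamma> xbar \<zeta>bar (- d k) a"
proof -
  have "\<forall>\<^sub>F k in sequentially. x (Suc k) = x k"
    using eventually_unsuccessful
    by eventually_elim (simp add: unsuccessful_def unsuccessful_update_def)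
  then obtain xbar where xbar: "\<forall>\<^sub>F k in sequentially. x k = xbar"
    using eventually_constant by blast
  then obtain K where "x K = xbar" by (auto simp: eventually_sequentially)
  then have "xbar \<in> cbox l u" using run_bounds[of K] by simp
  moreover have "\<forall>\<^sub>F k in sequentially. \<not> sufficient_decrease P l u \<gamma> xbar \<zeta>bar (d k) a
      \<and> \<not> sufficient_decrease P l u \<gamma> xbar \<zeta>bar (- d k) a"
    using eventually_unsuccessful xbar eventually_min_step eventually_final_accuracy
    by eventually_elim (auto simp: unsuccessful_def)
  ultimately show ?thesis using that xbar by blast
qed

end

section \<open>Failed polls in dense directions\<close>

lemma box_proj_in_cbox:
  assumes "cbox l u \<noteq> {}"
  shows "box_proj l u x \<in> cbox l u"
  using assms by (auto simp: box_proj_def mem_box_cart interval_ne_empty_cart)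

lemma box_proj_id: "x \<in> cbox l u \<Longrightarrow> box_proj l u x = x"
  by (simp add: box_proj_def mem_box_cart vec_eq_iff)

lemma continuous_box_proj: "isCont (box_proj l u) x"
  unfolding box_proj_def isCont_def
  by (intro tendsto_vec_lambda tendsto_max tendsto_min tendsto_intros)

text \<open>Density only promises one index per neighbourhood. From dimension two on the sphere has no isolated
  points, so finitely many directions can be discarded. In dimension one it can happen that one of
  the two unit vectors occurs only once, and allowing \<open>- d k\<close> repairs this; the
  algorithm polls both signs anyway.\<close>
lemma dense_in_sphere_frequently:
  fixes d :: "nat \<Rightarrow> real^'n"
  assumes dense: "dense_in_sphere d" and unit: "\<And>k. norm (d k) = 1"
    and e: "norm e = 1" and "0 < \<epsilon>"
  shows "\<exists>k\<ge>K. norm (d k - e) \<le> \<epsilon> \<or> norm (- d k - e) \<le> \<epsilon>"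
proof (cases "CARD('n) = 1")
  case True
  then obtain i where i: "(UNIV :: 'n set) = {i}" by (rule card_1_singletonE)
  have nrm: "norm z = \<bar>z $ i\<bar>" for z :: "real^'n" by (simp add: norm_vec_def i)
  have eq: "z = z' \<longleftrightarrow> z $ i = z' $ i" for z z' :: "real^'n"
  proof
    assume "z $ i = z' $ i"
    moreover have "j = i" for j using i by blast
    ultimately show "z = z'" unfolding vec_eq_iff by metis
  qed simp
  have "d K = e \<or> - d K = e"
    using unit[of K] e unfolding eq nrm vector_uminus_component by linarith
  then show ?thesis using \<open>0 < \<epsilon>\<close> by (intro exI[of _ K]) auto
next
  case False
  moreover have "0 < CARD('n)" by simp
  ultimately have "2 \<le> CARD('n)" by linarith
  then have "connected (sphere (0::real^'n) 1)" by (intro connected_sphere) simp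
  moreover have "sphere (0::real^'n) 1 \<noteq> {z}" for z
  proof
    assume "sphere (0::real^'n) 1 = {z}"
    moreover have "e \<in> sphere 0 1" "- e \<in> sphere 0 1" using e by simp_all
    ultimately have "e = - e" by (metis singletonD)
    then have "e + e = 0" by (rule eq_neg_iff_add_eq_0[THEN iffD1])
    then have "2 *\<^sub>R e = 0" by (metis scaleR_2)
    then show False using e by auto
  qed
  moreover have "e \<in> sphere 0 1" using e by simp
  ultimately have "e islimpt sphere 0 1" by (metis connected_imp_perfect)
  then have "infinite (sphere 0 1 \<inter> ball e (\<epsilon> / 2))"
    using \<open>0 < \<epsilon>\<close> by (simp add: islimpt_eq_infinite_ball)
  then have "infinite (sphere 0 1 \<inter> ball e (\<epsilon> / 2) - d ` {..<K})" by (simp add: Diff_infinite_finite)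
  from infinite_imp_nonempty[OF this]
  obtain e' where "e' \<in> sphere 0 1 \<inter> ball e (\<epsilon> / 2) - d ` {..<K}"
    unfolding ex_in_conv[symmetric] by (elim exE)
  then have e': "e' \<in> sphere 0 1" "dist e e' < \<epsilon> / 2" "e' \<notin> d ` {..<K}" by simp_all
  obtain \<rho> where \<rho>: "0 < \<rho>" "\<And>z. z \<in> d ` {..<K} \<Longrightarrow> \<rho> \<le> dist e' z"
    using finite_set_avoid[OF finite_imageI[OF finite_lessThan], of d K e'] e'(3) by metis
  have "0 < min (\<epsilon> / 2) (\<rho> / 2)" using \<open>0 < \<epsilon>\<close> \<rho>(1) by simp
  then obtain k where k: "norm (d k - e') \<le> min (\<epsilon> / 2) (\<rho> / 2)"
    using dense[unfolded dense_in_sphere_def, rule_format, OF e'(1)] by blast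
  have "dist e' (d k) < \<rho>" using k \<rho>(1) by (simp add: dist_norm norm_minus_commute)
  then have "d k \<notin> d ` {..<K}" using \<rho>(2)[of "d k"] by linarith
  then have "K \<le> k" by (meson imageI lessThan_iff not_le)
  moreover have "norm (d k - e) \<le> \<epsilon>"
    using norm_triangle_ineq[of "d k - e'" "e' - e"] k e'(2)
    by (simp add: dist_norm norm_minus_commute)
  ultimately show ?thesis by blast
qed

text \<open>A feasible point on the sphere of radius \<open>a\<close> is its own projection, so a value of \<open>g\<close> there below
  the claimed bound would, by continuity, persist for the projected trial points of all directions
  close to it, and one of these directions is polled after \<open>xbar\<close> is reached. The error \<open>e\<close> is paid
  twice, at \<open>xbar\<close> and at the trial point.\<close>
lemma sphere_values_if_polls_fail:
  fixes d :: "nat \<Rightarrow> real^'n"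
  assumes dense: "dense_in_sphere d" and unit: "\<And>k. norm (d k) = 1"
    and cont: "continuous_on UNIV g" and xbar: "xbar \<in> cbox l u" and a: "0 < a"
    and close: "\<And>z. z \<in> cbox l u \<Longrightarrow> \<bar>P z w - g z\<bar> \<le> e"
    and fail: "\<forall>\<^sub>F k in sequentially. \<not> sufficient_decrease P l u \<gamma> xbar w (d k) a
      \<and> \<not> sufficient_decrease P l u \<gamma> xbar w (- d k) a"
    and z: "z \<in> cbox l u" "norm (z - xbar) = a"
  shows "g xbar - (\<gamma> * a\<^sup>2 + 2 * e) \<le> g z"
proof (rule ccontr)
  define \<phi> where "\<phi> p = g (box_proj l u (xbar + a *\<^sub>R p))" for p
  define q where "q = (1 / a) *\<^sub>R (z - xbar)"
  have q: "norm q = 1" "xbar + a *\<^sub>R q = z" using z a by (simp_all add: q_def)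
  have "isCont \<phi> q"
    unfolding \<phi>_def
    by (rule isCont_o2[OF _ isCont_o2[OF continuous_box_proj]])
      (use cont in \<open>auto simp: continuous_on_eq_continuous_at intro!: continuous_intros\<close>)
  then have "(\<phi> \<longlongrightarrow> \<phi> q) (nhds q)"
    by (simp add: isCont_def tendsto_at_iff_tendsto_nhds)
  moreover assume "\<not> ?thesis"
  then have "\<phi> q < g xbar - (\<gamma> * a\<^sup>2 + 2 * e)" by (simp add: \<phi>_def q box_proj_id z)
  ultimately have "\<forall>\<^sub>F p in nhds q. \<phi> p < g xbar - (\<gamma> * a\<^sup>2 + 2 * e)"
    by (rule order_tendstoD(2))
  then obtain \<rho> where \<rho>: "0 < \<rho>" "\<And>p. dist p q < \<rho> \<Longrightarrow> \<phi> p < g xbar - (\<gamma> * a\<^sup>2 + 2 * e)"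
    by (auto simp: eventually_nhds_metric)
  have decrease: "sufficient_decrease P l u \<gamma> xbar w p a" if "norm (p - q) \<le> \<rho> / 2" for p
  proof -
    have "dist p q < \<rho>" using that \<rho>(1) by (simp add: dist_norm)
    moreover have "box_proj l u (xbar + a *\<^sub>R p) \<in> cbox l u"
      using xbar by (intro box_proj_in_cbox) blast
    ultimately show ?thesis
      using \<rho>(2)[of p] close[of "box_proj l u (xbar + a *\<^sub>R p)"] close[OF xbar]
      unfolding sufficient_decrease_def \<phi>_def abs_le_iff by linarith
  qed
  obtain K where "\<And>k. K \<le> k \<Longrightarrow> \<not> sufficient_decrease P l u \<gamma> xbar w (d k) a
      \<and> \<not> sufficient_decrease P l u \<gamma> xbar w (- d k) a"
    using fail by (auto simp: eventually_sequentially)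
  moreover obtain k where "K \<le> k" "norm (d k - q) \<le> \<rho> / 2 \<or> norm (- d k - q) \<le> \<rho> / 2"
    using dense_in_sphere_frequently[OF dense unit q(1), of "\<rho> / 2" K] \<rho>(1) by auto
  ultimately show False using decrease by blast
qed

section \<open>Goldstein stationarity of the final iterate\<close>

theorem theorem2:
  fixes l u :: "real^'n"
    and F f :: "real^'n \<Rightarrow> real^'m \<Rightarrow> real"
    and Z :: "(real^'m) set"
    and y :: "real^'n \<Rightarrow> real^'m"
    and yt :: "real^'n \<Rightarrow> real \<Rightarrow> real^'m"
    and L_F L_Fbar F_low :: real
    and \<gamma> \<delta>h \<theta> \<sigma> \<zeta>bar :: real
    and d x :: "nat \<Rightarrow> real^'n"
    and \<alpha>t \<zeta> :: "nat \<Rightarrow> real"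
  assumes "\<And>x. x \<in> cbox l u \<Longrightarrow> y x \<in> reaction_set f Z x"
    and "\<And>x \<zeta>. x \<in> cbox l u \<Longrightarrow> \<zeta> > 0 \<Longrightarrow> norm (yt x \<zeta> - y x) \<le> \<zeta>"
    and "\<And>x. L_F-lipschitz_on UNIV (F x)"
    and "L_Fbar-lipschitz_on UNIV (true_objective F y)"
    and "\<And>x. x \<in> cbox l u \<Longrightarrow> true_objective F y x \<ge> F_low"
    and "\<gamma> > 0" and "\<delta>h \<in> {0<..<1}"
    and "\<theta> \<in> {0<..<1}" and "\<sigma> \<in> {0<..<1}" and "\<zeta>bar > 0"
    and "\<And>k. norm (d k) = 1"
    and "dense_in_sphere d"
    and "dfn_lla_run (perturbed_objective F yt) l u \<gamma> \<delta>h \<theta> \<sigma> \<zeta>bar d x \<alpha>t \<zeta>"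
  shows "\<exists>xbar. (\<forall>\<^sub>F k in sequentially. x k = xbar) \<and>
    (\<forall>z. (\<exists>r :: nat \<Rightarrow> nat. strict_mono r \<and> (x \<circ> r) \<longlonglongrightarrow> z) \<longleftrightarrow> z = xbar) \<and>
    goldstein_stationary (true_objective F y) l u
      (alpha_min \<sigma> \<zeta>bar)
      (4 * \<gamma> * alpha_min \<sigma> \<zeta>bar + 8 * L_F * \<zeta>bar / alpha_min \<sigma> \<zeta>bar) xbar"
proof -
  let ?g = "true_objective F y" and ?P = "perturbed_objective F yt" and ?a = "alpha_min \<sigma> \<zeta>bar"
  have close: "\<bar>?P z w - ?g z\<bar> \<le> L_F * w" if "z \<in> cbox l u" "0 < w" for z w
  proof -
    have "\<bar>?P z w - ?g z\<bar> \<le> L_F * norm (yt z w - y z)"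
      using lipschitz_onD[OF assms(3), of "yt z w" "y z" z]
      by (simp add: perturbed_objective_def true_objective_def dist_norm)
    also have "\<dots> \<le> L_F * w"
      using assms(2)[OF that] lipschitz_on_nonneg[OF assms(3)] by (intro mult_left_mono) auto
    finally show ?thesis .
  qed
  interpret run: positive_accuracy_run ?P l u \<gamma> \<delta>h \<theta> \<sigma> \<zeta>bar d x \<alpha>t \<zeta>
  proof
    fix w :: real assume "0 < w"
    have "F_low - L_F * w \<le> ?P z w" if "z \<in> cbox l u" for z
      using close[OF that \<open>0 < w\<close>] assms(5)[OF that] by linarith
    then show "\<exists>B. \<forall>z\<in>cbox l u. B \<le> ?P z w" by blast
  qed (fact assms)+
  obtain xbar where xbar: "xbar \<in> cbox l u" "\<forall>\<^sub>F k in sequentially. x k = xbar"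
    and fail: "\<forall>\<^sub>F k in sequentially. \<not> sufficient_decrease ?P l u \<gamma> xbar \<zeta>bar (d k) ?a
      \<and> \<not> sufficient_decrease ?P l u \<gamma> xbar \<zeta>bar (- d k) ?a"
    by (rule run.run_stalls)
  define \<eta> where "\<eta> = \<gamma> * ?a\<^sup>2 + 2 * (L_F * \<zeta>bar)"
  define \<epsilon> where "\<epsilon> = 4 * \<gamma> * ?a + 8 * L_F * \<zeta>bar / ?a"
  have a: "0 < ?a" by (rule run.alpha_min_pos)
  have L_F: "0 \<le> L_F" by (rule lipschitz_on_nonneg[OF assms(3)])
  have "0 < \<eta>"
    unfolding \<eta>_def using L_F a assms(6,10) by (intro add_pos_nonneg) simp_all
  have \<epsilon>: "\<epsilon> * ?a = 4 * \<eta>"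
    using a by (simp add: \<epsilon>_def \<eta>_def field_simps power2_eq_square)
  have sphere: "?g xbar - \<eta> \<le> ?g z" if "z \<in> cbox l u" "norm (z - xbar) = ?a" for z
    unfolding \<eta>_def
    using sphere_values_if_polls_fail[OF assms(12,11) lipschitz_on_continuous_on[OF assms(4)]
        xbar(1) a close[OF _ assms(10)] fail that] .
  have "0 < \<epsilon> * ?a" using \<epsilon> \<open>0 < \<eta>\<close> by simp
  then have "0 < \<epsilon>" using a by (simp add: zero_less_mult_iff)
  moreover have "2 * \<eta> < \<epsilon> * ?a" using \<epsilon> \<open>0 < \<eta>\<close> by simp
  ultimately have "goldstein_stationary ?g l u ?a \<epsilon> xbar"
    using sphere by (rule goldstein_stationary_if_sphere_values[OF assms(4) xbar(1) a])
  then show ?thesis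
    unfolding \<epsilon>_def
    by (intro exI[of _ xbar] conjI allI xbar(2) limit_points_of_eventually_constant[OF xbar(2)])
qed

end
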